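(* Let $\epsilon\in\{1,-1\}$, let $(X,T)\in\mathbb{C}^{n\times 2n}\times\mathbb{C}^{2n\times 2n}$ with $T$ nonsingular, and suppose that $W=\begin{bmatrix}X\\-XT^{-1}\end{bmatrix}$ is nonsingular. Then there exists a regular solution to the problem IEP-QP$(2n)$ with data $(X,T)$, i.e. there exist $A_1,A_0\in\mathbb{C}^{n\times n}$ with $A_1$ nonsingular, $A_0^{\star}=\epsilon A_0$ and $$A_1^{\star}XT^2+A_0XT+\epsilon A_1X=0,$$ if and only if there exists a nonsingular $S\in\mathbb{S}_{(X,T)}$. In such case, the coefficient matrices of the solution $Q(\lambda)=\lambda^2A_1^{\star}+\lambda A_0+\epsilon A_1$ are given, in terms of $X$, $T$ and such an $S$, by $$A_1=\epsilon\,(XT^{-1}SX^{\star})^{-1},\qquad A_0=-A_1XT^{-2}SX^{\star}A_1 .$$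
   Context: The symbol $\star$ denotes one fixed operation, either the transpose $\top$ or the conjugate transpose $*$ (for complex matrices). For $(X,T)\in\mathbb{C}^{n\times k}\times\mathbb{C}^{k\times k}$: $\mathbb{S}_T=\{S\in\mathbb{C}^{k\times k}: S^{\star}=-\epsilon S,\ S=TST^{\star}\}$ and $\mathbb{S}_{(X,T)}=\{S\in\mathbb{S}_T: XSX^{\star}=0\}$. IEP-QP$(2n)$: given $(X,T)\in\mathbb{C}^{n\times 2n}\times\mathbb{C}^{2n\times 2n}$ with $\begin{bmatrix}X\\-XT^{-1}\end{bmatrix}$ nonsingular, construct a $\star$-(anti)-palindromic system $Q(\lambda)=\lambda^2A_1^{\star}+\lambda A_0+\epsilon A_1$ ($A_0^{\star}=\epsilon A_0$) with $A_1^{\star}XT^2+A_0XT+\epsilon A_1X=0$. A solution is regular if $A_1$ is nonsingular. *)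

theory Defs
  imports "HOL-Analysis.Analysis"
begin

text \<open>Matrices with rows indexed by \<open>'r\<close> and columns indexed by \<open>'c\<close> have type
  \<open>complex^'c^'r\<close>. With \<open>n = CARD('n)\<close>, the index set of size \<open>2n\<close> is \<open>'n + 'n\<close>.\<close>

datatype star_op = Transpose | Conjugate_Transpose

fun star :: "star_op \<Rightarrow> complex^'c^'r \<Rightarrow> complex^'r^'c" where
  "star Transpose A = transpose A"
| "star Conjugate_Transpose A = (\<chi> i j. cnj (A $ j $ i))"

definition stack :: "complex^'c^'a \<Rightarrow> complex^'c^'b \<Rightarrow> complex^'c^('a + 'b)" where
  "stack A B = (\<chi> i. case i of Inl a \<Rightarrow> A $ a | Inr b \<Rightarrow> B $ b)"

definition S_T :: "star_op \<Rightarrow> real \<Rightarrow> complex^'k^'k \<Rightarrow> (complex^'k^'k) set" where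
  "S_T st \<epsilon> T = {S. star st S = - (\<epsilon> *\<^sub>R S) \<and> S = T ** S ** star st T}"

definition S_XT ::
  "star_op \<Rightarrow> real \<Rightarrow> complex^'k^'n \<Rightarrow> complex^'k^'k \<Rightarrow> (complex^'k^'k) set" where
  "S_XT st \<epsilon> X T = {S \<in> S_T st \<epsilon> T. X ** S ** star st X = 0}"

text \<open>A system \<open>Q(\<lambda>) = \<lambda>\<^sup>2 A1\<^sup>\<star> + \<lambda> A0 + \<epsilon> A1\<close> is represented by its pair of coefficients
  \<open>(A1, A0)\<close>; it is \<open>\<star>\<close>-palindromic (\<open>\<epsilon> = 1\<close>) or \<open>\<star>\<close>-anti-palindromic (\<open>\<epsilon> = -1\<close>)
  when \<open>A0\<^sup>\<star> = \<epsilon> A0\<close>.\<close>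

definition IEP_QP_solution ::
  "star_op \<Rightarrow> real \<Rightarrow> complex^('n + 'n)^'n \<Rightarrow> complex^('n + 'n)^('n + 'n)
    \<Rightarrow> complex^'n^'n \<Rightarrow> complex^'n^'n \<Rightarrow> bool" where
  "IEP_QP_solution st \<epsilon> X T A1 A0 \<longleftrightarrow>
     star st A0 = \<epsilon> *\<^sub>R A0 \<and>
     star st A1 ** X ** (T ** T) + A0 ** X ** T + (\<epsilon> *\<^sub>R A1) ** X = 0"

definition regular_IEP_QP_solution ::
  "star_op \<Rightarrow> real \<Rightarrow> complex^('n + 'n)^'n \<Rightarrow> complex^('n + 'n)^('n + 'n)
    \<Rightarrow> complex^'n^'n \<Rightarrow> complex^'n^'n \<Rightarrow> bool" where
  "regular_IEP_QP_solution st \<epsilon> X T A1 A0 \<longleftrightarrow>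
     IEP_QP_solution st \<epsilon> X T A1 A0 \<and> invertible A1"

end

theory Submission
  imports Defs
begin

text \<open>
  Write \<open>R = T\<inverse>\<close>, \<open>W = [X; -XR]\<close>. The whole correspondence comes from computing
  \<open>W S W\<^sup>\<star>\<close> blockwise. If \<open>S\<close> lies in the set \<open>S_XT st \<epsilon> X T\<close>, then \<open>T S T\<^sup>\<star> = S\<close> gives
  \<open>R S R\<^sup>\<star> = S\<close>, so both diagonal blocks equal \<open>X S X\<^sup>\<star> = 0\<close>, and
  \<open>W S W\<^sup>\<star> = [0, \<epsilon>M\<^sup>\<star>; -M, 0]\<close> with \<open>M = X R S X\<^sup>\<star>\<close>. Hence \<open>M\<close> is nonsingular as soon as \<open>S\<close> is
  (\<open>middle_block_invertible\<close>).

  For such an \<open>S\<close>, put \<open>A1 = \<epsilon> M\<inverse>\<close>, \<open>N = X R\<^sup>2 S X\<^sup>\<star>\<close> and \<open>A0 = -A1 N A1\<close>. The residual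
  \<open>P = A1\<^sup>\<star> X T + A0 X + \<epsilon> A1 X R\<close>, which is the matrix equation multiplied by \<open>R\<close> on the right,
  is killed by \<open>S X\<^sup>\<star>\<close> and by \<open>R S X\<^sup>\<star>\<close>: each product reduces to \<open>M\<close>, \<open>N\<close> and the vanishing
  block. The columns of these two matrices together span the whole space, because
  \<open>R S X\<^sup>\<star> = S (X T)\<^sup>\<star>\<close> and \<open>[XT; X] = [X; XR] T\<close> is nonsingular, so \<open>P = 0\<close> (\<open>annihilator_zero\<close>). The symmetry
  \<open>A0\<^sup>\<star> = \<epsilon> A0\<close> is not visible from the formula; it follows by testing the identity \<open>P = 0\<close>
  against a third matrix, \<open>S R\<^sup>\<star> X\<^sup>\<star>\<close> (\<open>solution_from_S\<close>).

  Conversely, given a regular solution, the block formula forces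
  \<open>S = W\<inverse> [0, A1\<^sup>-\<^sup>\<star>; -\<epsilon> A1\<inverse>, 0] W\<^sup>-\<^sup>\<star>\<close>. Its inverse is
  \<open>G = \<epsilon> X\<^sup>\<star> A1 X R - R\<^sup>\<star> X\<^sup>\<star> A1\<^sup>\<star> X\<close>, and the matrix equation together with its \<open>\<star>\<close>-image turns
  \<open>T\<^sup>\<star> G T\<close> back into \<open>G\<close>, which is \<open>S = T S T\<^sup>\<star>\<close> (\<open>S_from_solution\<close>).

  The block matrix \<open>W\<close> enters only through the two column blocks \<open>Y\<close>, \<open>Z\<close> of its inverse
  (\<open>invertible_stack_blocks\<close>), so everything reduces to products of unpartitioned matrices.
\<close>

section \<open>Matrix identities\<close>

text \<open>Products are normalised by associating them to the right. A known product of two or three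
  factors then occurs as a prefix of a longer chain, where its own equation does not match; the next
  two lemmas turn it into one that does.\<close>

lemma matrix_mult_assoc4:
  fixes A :: "'a::comm_semiring_1^'m^'l" and B :: "'a^'n^'m" and C :: "'a^'o^'n" and E :: "'a^'p^'o"
  assumes "A ** (B ** C) = D" shows "A ** (B ** (C ** E)) = D ** E"
  using assms by (simp add: matrix_mul_assoc)

lemma matrix_mult_assoc3:
  fixes A :: "'a::comm_semiring_1^'m^'l" and B :: "'a^'n^'m" and C :: "'a^'o^'n"
  assumes "A ** B = D" shows "A ** (B ** C) = D ** C"
  using assms by (simp add: matrix_mul_assoc)

lemma matrix_mult_minus_left:
  fixes A :: "'a::comm_ring_1^'m^'l" and B :: "'a^'n^'m"
  shows "(- A) ** B = - (A ** B)"
  by (simp add: vec_eq_iff matrix_matrix_mult_def sum_negf)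

lemma matrix_mult_minus_right:
  fixes A :: "'a::comm_ring_1^'m^'l" and B :: "'a^'n^'m"
  shows "A ** (- B) = - (A ** B)"
  by (simp add: vec_eq_iff matrix_matrix_mult_def sum_negf)

lemma matrix_mult_diff_left:
  fixes A B :: "'a::comm_ring_1^'m^'l" and C :: "'a^'n^'m"
  shows "(A - B) ** C = A ** C - B ** C"
  by (simp add: vec_eq_iff matrix_matrix_mult_def left_diff_distrib sum_subtractf)

lemma matrix_mult_diff_right:
  fixes A :: "'a::comm_ring_1^'m^'l" and B C :: "'a^'n^'m"
  shows "A ** (B - C) = A ** B - A ** C"
  by (simp add: vec_eq_iff matrix_matrix_mult_def right_diff_distrib sum_subtractf)

lemma matrix_mult_add_left:
  fixes A B :: "'a::comm_ring_1^'m^'l" and C :: "'a^'n^'m"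
  shows "(A + B) ** C = A ** C + B ** C"
  by (simp add: vec_eq_iff matrix_matrix_mult_def distrib_right sum.distrib)

lemma matrix_mult_zero_left: "(0 :: 'a::comm_ring_1^'m^'l) ** (B :: 'a^'n^'m) = 0"
  by (simp add: vec_eq_iff matrix_matrix_mult_def)

lemma matrix_mult_zero_right: "(A :: 'a::comm_ring_1^'m^'l) ** (0 :: 'a^'n^'m) = 0"
  by (simp add: vec_eq_iff matrix_matrix_mult_def)

lemmas matrix_expand =
  matrix_mul_assoc[symmetric] matrix_mult_minus_left matrix_mult_minus_right
  scalar_matrix_assoc[symmetric] matrix_scalar_ac matrix_mult_diff_left matrix_mult_diff_right
  matrix_add_ldistrib matrix_mult_add_left matrix_mult_zero_left matrix_mult_zero_right

lemma matrix_inv_mult: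
  fixes A :: "'a::semiring_1^'n^'n"
  assumes "invertible A"
  shows "A ** matrix_inv A = mat 1" "matrix_inv A ** A = mat 1"
  using someI_ex[OF assms[unfolded invertible_def]] by (simp_all add: matrix_inv_def)

lemma matrix_inv_eqI:
  fixes A :: "'a::semiring_1^'n^'n"
  assumes "A ** B = mat 1" "B ** A = mat 1"
  shows "matrix_inv A = B"
proof -
  have "invertible A" using assms unfolding invertible_def by blast
  then have "matrix_inv A ** (A ** B) = B" by (simp add: matrix_mul_assoc matrix_inv_mult)
  then show ?thesis by (simp add: assms)
qed

lemma star_mult: "star st (A ** B) = star st B ** star st A"
  by (cases st)
    (simp_all add: matrix_transpose_mul, simp add: vec_eq_iff matrix_matrix_mult_def mult.commute)

lemma star_star: "star st (star st A) = A"
  by (cases st) (simp_all add: vec_eq_iff)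

lemma star_add: "star st (A + B) = star st A + star st B"
  by (cases st) (simp_all add: vec_eq_iff transpose_def)

lemma star_diff: "star st (A - B) = star st A - star st B"
  by (cases st) (simp_all add: vec_eq_iff transpose_def)

lemma star_minus: "star st (- A) = - star st A"
  by (cases st) (simp_all add: vec_eq_iff transpose_def)

lemma star_scaleR: "star st (c *\<^sub>R A) = c *\<^sub>R star st A"
  by (cases st) (simp_all add: vec_eq_iff transpose_def)

lemma star_zero: "star st 0 = 0"
  by (cases st) (simp_all add: vec_eq_iff transpose_def)

lemma star_one: "star st (mat 1) = mat 1"
  by (cases st) (simp_all add: vec_eq_iff mat_def transpose_def)

lemmas star_expand =
  star_mult star_star star_add star_diff star_minus star_scaleR star_zero star_one

text \<open>\<open>Y\<close> and \<open>Z\<close> are the left and right column blocks of the inverse of the stacked matrix; the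
  five equations are the two inverse laws read blockwise.\<close>

lemma invertible_stack_blocks:
  fixes A :: "complex^('a::finite + 'b::finite)^'a" and B :: "complex^('a + 'b)^'b"
  assumes "invertible (stack A B)"
  obtains Y Z where "A ** Y = mat 1" "A ** Z = 0" "B ** Y = 0" "B ** Z = mat 1"
    "Y ** A + Z ** B = mat 1"
proof -
  obtain V where V: "stack A B ** V = mat 1" "V ** stack A B = mat 1"
    using assms unfolding invertible_def by blast
  define Y :: "complex^'a^('a + 'b)" where "Y = (\<chi> i j. V $ i $ Inl j)"
  define Z :: "complex^'b^('a + 'b)" where "Z = (\<chi> i j. V $ i $ Inr j)"
  have 1: "(stack A B ** V) $ i $ j = mat 1 $ i $ j" for i j using V by simp
  have "A ** Y = mat 1" unfolding vec_eq_iff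
  proof (intro allI)
    fix i j show "(A ** Y) $ i $ j = mat 1 $ i $ j"
      using 1[of "Inl i" "Inl j"]
      by (simp add: stack_def matrix_matrix_mult_def Y_def mat_def)
  qed
  moreover have "A ** Z = 0" unfolding vec_eq_iff
  proof (intro allI)
    fix i j show "(A ** Z) $ i $ j = 0 $ i $ j"
      using 1[of "Inl i" "Inr j"]
      by (simp add: stack_def matrix_matrix_mult_def Z_def mat_def)
  qed
  moreover have "B ** Y = 0" unfolding vec_eq_iff
  proof (intro allI)
    fix i j show "(B ** Y) $ i $ j = 0 $ i $ j"
      using 1[of "Inr i" "Inl j"]
      by (simp add: stack_def matrix_matrix_mult_def Y_def mat_def)
  qed
  moreover have "B ** Z = mat 1" unfolding vec_eq_iff
  proof (intro allI)
    fix i j show "(B ** Z) $ i $ j = mat 1 $ i $ j"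
      using 1[of "Inr i" "Inr j"]
      by (simp add: stack_def matrix_matrix_mult_def Z_def mat_def)
  qed
  moreover have "Y ** A + Z ** B = V ** stack A B"
    by (simp add: vec_eq_iff stack_def matrix_matrix_mult_def Y_def Z_def UNIV_Plus_UNIV[symmetric]
        sum.Plus del: UNIV_Plus_UNIV)
  ultimately show ?thesis using that V by metis
qed

section \<open>From a nonsingular S to a solution\<close>

text \<open>In this section and the next, \<open>Xs\<close>, \<open>Ts\<close>, \<open>Rs\<close>, \<open>Ys\<close>, \<open>Zs\<close>, \<open>A1s\<close>, \<open>Bs\<close> stand for the
  \<open>\<star>\<close>-images; the preparatory lemmas know them only through the products listed as hypotheses.
  The equation \<open>S = T S T\<^sup>\<star>\<close> allows a factor \<open>R\<close> or \<open>T\<close> on the left of \<open>S\<close> to be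
  exchanged for \<open>T\<^sup>\<star>\<close> or \<open>R\<^sup>\<star>\<close> on the right.\<close>

lemma S_T_shift:
  assumes "S = T ** S ** Ts" "R ** T = mat 1" "T ** R = mat 1" "Ts ** Rs = mat 1"
  shows "R ** S = S ** Ts" "T ** S = S ** Rs" "R ** S ** Rs = S"
proof -
  show 1: "R ** S = S ** Ts"
    by (subst assms(1)) (simp add: matrix_mul_assoc assms(2-))
  show "T ** S = S ** Rs"
    by (subst (2) assms(1)) (simp add: matrix_mul_assoc[symmetric] assms(2-))
  show "R ** S ** Rs = S"
    unfolding 1 by (simp add: matrix_mul_assoc[symmetric] assms(2-))
qed

text \<open>Multiplying \<open>X ** R ** S\<close> by the resolution \<open>Xs ** Ys - Rs ** Xs ** Zs\<close> of the identity, the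
  second term is annihilated, so that \<open>X ** R ** S\<close> factors through
  \<open>M = X ** R ** S ** Xs\<close>. As \<open>S\<close> is nonsingular and \<open>X ** R\<close> has a right inverse, \<open>M\<close> has one too.\<close>

lemma middle_block_invertible:
  fixes X :: "complex^'k^'n" and Xs :: "complex^'n^'k"
  assumes "X ** R ** S ** Rs ** Xs = 0" "invertible S"
    and "Xs ** Ys - Rs ** Xs ** Zs = mat 1" "X ** R ** Z = - mat 1"
  shows "invertible (X ** R ** S ** Xs)"
proof -
  let ?M = "X ** R ** S ** Xs"
  obtain G where G: "S ** G = mat 1" using assms unfolding invertible_def by blast
  have "X ** R ** S = X ** R ** S ** (Xs ** Ys - Rs ** Xs ** Zs)"
    using assms by simp
  also have "\<dots> = ?M ** Ys - X ** R ** S ** Rs ** Xs ** Zs"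
    by (simp add: matrix_expand)
  finally have 1: "X ** R ** S = ?M ** Ys" using assms by (simp add: matrix_mult_zero_left)
  have "?M ** (- (Ys ** G ** Z)) = - (X ** R ** (S ** G) ** Z)"
    using 1 by (simp add: matrix_mult_minus_right matrix_mul_assoc)
  also have "\<dots> = mat 1" using assms G by simp
  finally show ?thesis unfolding invertible_right_inverse by blast
qed


text \<open>Since \<open>R ** S = S ** Ts\<close>, the hypotheses say that \<open>U = P ** S ** Ts\<close> vanishes on \<open>Xs\<close> and on
  \<open>Rs ** Xs\<close>. The columns of these span the whole space by the resolution of the identity, and
  \<open>S ** Ts\<close> is nonsingular.\<close>

lemma annihilator_zero:
  fixes P :: "complex^'k^'n"
  assumes "P ** S ** Xs = 0" "P ** R ** S ** Xs = 0"
    and S: "R ** S = S ** Ts" and inv: "Ts ** Rs = mat 1" "S ** G = mat 1"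
    and id: "Xs ** Ys - Rs ** Xs ** Zs = mat 1"
  shows "P = 0"
proof -
  let ?U = "P ** S ** Ts"
  have 1: "?U ** Xs = 0"
    using assms(2) by (simp add: matrix_mul_assoc[symmetric] matrix_mult_assoc3[OF S])
  have "?U ** Rs ** Xs = P ** S ** (Ts ** Rs) ** Xs" by (simp add: matrix_mul_assoc)
  with assms(1) inv have 2: "?U ** Rs ** Xs = 0" by simp
  have "?U = ?U ** (Xs ** Ys - Rs ** Xs ** Zs)" by (simp add: id)
  also have "\<dots> = (?U ** Xs) ** Ys - (?U ** Rs ** Xs) ** Zs"
    by (simp add: matrix_mult_diff_right matrix_mul_assoc)
  finally have "?U = 0" unfolding 1 2 by (simp add: matrix_mult_zero_left)
  moreover have "P = ?U ** Rs ** G"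
    using inv by (simp add: matrix_mul_assoc[symmetric] matrix_mult_assoc3[OF inv(1)])
  ultimately show ?thesis by (simp add: matrix_mult_zero_left)
qed

text \<open>The scalar enters only through \<open>\<epsilon>\<^sup>2 = 1\<close>. The equation is obtained from the residual \<open>P\<close> by
  \<open>annihilator_zero\<close>; the symmetry of \<open>A0\<close> is then read off from \<open>P = 0\<close>, by expressing \<open>A0\<close> a
  second time, through \<open>N\<^sup>\<star>\<close> instead of \<open>N\<close>.\<close>

lemma solution_from_S:
  fixes X :: "complex^('n::finite + 'n)^'n" and T S R :: "complex^('n + 'n)^('n + 'n)"
  assumes e: "\<epsilon> * \<epsilon> = 1" and TR: "T ** R = mat 1" "R ** T = mat 1"
    and S: "S \<in> S_XT st \<epsilon> X T" "invertible S"
    and YZ: "X ** R ** Z = - mat 1" "Y ** X - Z ** X ** R = mat 1"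
  defines "M \<equiv> X ** R ** S ** star st X"
  defines "A1 \<equiv> \<epsilon> *\<^sub>R matrix_inv M"
  shows "invertible M"
    and "regular_IEP_QP_solution st \<epsilon> X T A1 (- (A1 ** X ** (R ** R) ** S ** star st X ** A1))"
proof -
  define Xs Ts Rs Ys Zs where star_defs: "Xs = star st X" "Ts = star st T" "Rs = star st R"
    "Ys = star st Y" "Zs = star st Z"
  have Ss: "star st S = - (\<epsilon> *\<^sub>R S)" and ST: "S = T ** S ** Ts" and XSX: "X ** S ** Xs = 0"
    using S by (auto simp: S_XT_def S_T_def star_defs)
  have TRs: "Ts ** Rs = mat 1" "Rs ** Ts = mat 1"
    using arg_cong[OF TR(1), of "star st"] arg_cong[OF TR(2), of "star st"]
    by (simp_all add: star_expand star_defs)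
  have YZs: "Xs ** Ys - Rs ** Xs ** Zs = mat 1"
    using arg_cong[OF YZ(2), of "star st"]
    by (simp add: star_expand star_defs matrix_mul_assoc)
  note shift = S_T_shift[OF ST TR(2) TR(1) TRs(1)]
  obtain G where G: "S ** G = mat 1" using S(2) unfolding invertible_def by blast
  have XRSRX: "X ** R ** S ** Rs ** Xs = 0"
    using XSX shift(3) by (metis matrix_mul_assoc)
  show M: "invertible M"
    unfolding M_def using middle_block_invertible[OF XRSRX S(2) YZs YZ(1)]
    by (simp add: star_defs)
  define L where "L = matrix_inv M"
  have Minv: "M ** L = mat 1" "L ** M = mat 1"
    using M by (simp_all add: L_def matrix_inv_mult)
  have Minvs: "star st L ** star st M = mat 1" "star st M ** star st L = mat 1"
    using arg_cong[OF Minv(1), of "star st"] arg_cong[OF Minv(2), of "star st"]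
    by (simp_all add: star_expand)
  have A1: "A1 = \<epsilon> *\<^sub>R L" by (simp add: A1_def L_def)
  define N where "N = X ** R ** R ** S ** Xs"
  define A0 where "A0 = - (A1 ** N ** A1)"
  have Ms: "X ** S ** Rs ** Xs = - (\<epsilon> *\<^sub>R star st M)"
    by (simp add: M_def star_expand Ss star_defs matrix_expand e)
  have Ms': "X ** T ** S ** Xs = - (\<epsilon> *\<^sub>R star st M)"
    using Ms shift(2) by (metis matrix_mul_assoc)
  have Ns: "X ** T ** S ** Rs ** Xs = - (\<epsilon> *\<^sub>R star st N)"
  proof -
    have "X ** T ** S ** Rs ** Xs = X ** S ** Rs ** Rs ** Xs"
      using shift(2) by (metis matrix_mul_assoc)
    then show ?thesis
      by (simp add: N_def star_expand Ss star_defs matrix_expand e)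
  qed
  \<comment> \<open>The residual of the equation after cancelling one factor \<open>T\<close>.\<close>
  define P where "P = star st A1 ** X ** T + A0 ** X + \<epsilon> *\<^sub>R (A1 ** X ** R)"
  have P1: "P ** S ** Xs = 0"
  proof -
    have "P ** S ** Xs = star st A1 ** (X ** T ** S ** Xs) + A0 ** (X ** S ** Xs) + \<epsilon> *\<^sub>R (A1 ** M)"
      by (simp add: P_def matrix_expand M_def star_defs)
    also have "\<dots> = 0"
      unfolding Ms' XSX A1 by (simp add: star_expand matrix_expand e Minvs Minv)
    finally show ?thesis .
  qed
  have P2: "P ** R ** S ** Xs = 0"
  proof -
    have "P ** R ** S ** Xs
        = star st A1 ** (X ** S ** Xs) + A0 ** M + \<epsilon> *\<^sub>R (A1 ** N)"
      by (simp add: P_def matrix_expand M_def N_def star_defs matrix_mult_assoc3[OF TR(1)])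
    also have "\<dots> = 0"
      unfolding XSX A0_def A1 by (simp add: matrix_expand e Minv)
    finally show ?thesis .
  qed
  have P0: "P = 0"
    by (rule annihilator_zero[OF P1 P2 shift(1) TRs(1) G YZs])
  have eq: "star st A1 ** X ** (T ** T) + A0 ** X ** T + (\<epsilon> *\<^sub>R A1) ** X = 0"
  proof -
    have "star st A1 ** X ** (T ** T) + A0 ** X ** T + (\<epsilon> *\<^sub>R A1) ** X = P ** T"
      by (simp add: P_def matrix_expand TR)
    then show ?thesis by (simp add: P0 matrix_mult_zero_left)
  qed
  \<comment> \<open>Testing \<open>P = 0\<close> against \<open>S ** Rs ** Xs\<close> brings in the \<open>\<star>\<close>-images of \<open>M\<close> and \<open>N\<close>.\<close>
  have "A0 ** star st M = - (star st A1 ** star st N)"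
  proof -
    have "P ** S ** Rs ** Xs = star st A1 ** (X ** T ** S ** Rs ** Xs)
        + A0 ** (X ** S ** Rs ** Xs) + \<epsilon> *\<^sub>R (A1 ** (X ** R ** S ** Rs ** Xs))"
      by (simp add: P_def matrix_expand)
    then have "\<epsilon> *\<^sub>R (star st A1 ** star st N + A0 ** star st M) = 0"
      unfolding P0 Ns Ms XRSRX by (simp add: matrix_expand scaleR_add_right neg_eq_iff_add_eq_0)
    moreover have "\<epsilon> \<noteq> 0" using e by auto
    ultimately show ?thesis by (simp add: eq_neg_iff_add_eq_0 add.commute)
  qed
  then have "A0 ** (star st M ** star st L) = - (star st A1 ** star st N ** star st L)"
    by (simp add: matrix_mul_assoc matrix_mult_minus_left)
  then have "A0 = - (star st A1 ** star st N ** star st L)" by (simp add: Minvs)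
  then have "star st A0 = \<epsilon> *\<^sub>R A0"
    unfolding A0_def by (simp add: A1 star_expand matrix_expand e)
  moreover have "invertible A1"
  proof -
    have "A1 ** (\<epsilon> *\<^sub>R M) = mat 1" by (simp add: A1 matrix_expand e Minv)
    then show ?thesis unfolding invertible_right_inverse by blast
  qed
  ultimately have "regular_IEP_QP_solution st \<epsilon> X T A1 A0"
    using eq by (simp add: regular_IEP_QP_solution_def IEP_QP_solution_def)
  then show "regular_IEP_QP_solution st \<epsilon> X T A1 (- (A1 ** X ** (R ** R) ** S ** star st X ** A1))"
    by (simp add: A0_def N_def star_defs matrix_mul_assoc)
qed

section \<open>From a solution to S\<close>

text \<open>With \<open>W\<inverse> = [Y, Z]\<close> and \<open>B = A1\<inverse>\<close>, the matrix
  \<open>S = Y B\<^sup>\<star> Z\<^sup>\<star> - \<epsilon> Z B Y\<^sup>\<star>\<close> is the only one for which \<open>W S W\<^sup>\<star>\<close> has zero diagonal blocks and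
  off-diagonal blocks \<open>B\<^sup>\<star>\<close> and \<open>-\<epsilon>B\<close>. Membership is checked on its inverse \<open>G\<close>, in which the
  coefficients appear without inverses, so that the matrix equation applies directly.\<close>

lemma S_from_solution:
  fixes X :: "complex^('n::finite + 'n)^'n" and T R :: "complex^('n + 'n)^('n + 'n)"
  assumes e: "\<epsilon> * \<epsilon> = 1" and TR: "T ** R = mat 1" "R ** T = mat 1"
    and XY: "X ** Y = mat 1" "X ** Z = 0" "X ** R ** Y = 0" "X ** R ** Z = - mat 1"
    and YZ: "Y ** X - Z ** X ** R = mat 1"
    and sol: "regular_IEP_QP_solution st \<epsilon> X T A1 A0"
  obtains S where "S \<in> S_XT st \<epsilon> X T" "invertible S"
    "A1 = \<epsilon> *\<^sub>R matrix_inv (X ** R ** S ** star st X)"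
    "A0 = - (A1 ** X ** (R ** R) ** S ** star st X ** A1)"
proof -
  obtain B where B: "A1 ** B = mat 1" "B ** A1 = mat 1"
    using sol unfolding regular_IEP_QP_solution_def invertible_def by blast
  define Xs Ts Rs Ys Zs A1s Bs where star_defs: "Xs = star st X" "Ts = star st T" "Rs = star st R"
    "Ys = star st Y" "Zs = star st Z" "A1s = star st A1" "Bs = star st B"
  have A0: "star st A0 = \<epsilon> *\<^sub>R A0"
    and eq: "A1s ** X ** (T ** T) + A0 ** X ** T + (\<epsilon> *\<^sub>R A1) ** X = 0"
    using sol by (simp_all add: regular_IEP_QP_solution_def IEP_QP_solution_def star_defs)
  have P0: "A1s ** X ** T + A0 ** X + \<epsilon> *\<^sub>R (A1 ** X ** R) = 0"
  proof -
    have "(A1s ** X ** (T ** T) + A0 ** X ** T + (\<epsilon> *\<^sub>R A1) ** X) ** R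
      = A1s ** X ** T + A0 ** X + \<epsilon> *\<^sub>R (A1 ** X ** R)"
      by (simp add: matrix_expand TR)
    then show ?thesis unfolding eq by (simp add: matrix_mult_zero_left)
  qed
  have TRs: "Ts ** Rs = mat 1" "Rs ** Ts = mat 1"
    using arg_cong[OF TR(1), of "star st"] arg_cong[OF TR(2), of "star st"]
    by (simp_all add: star_expand star_defs)
  have Bs: "A1s ** Bs = mat 1"
    using arg_cong[OF B(2), of "star st"] by (simp add: star_expand star_defs)
  have YZs: "Xs ** Ys - Rs ** Xs ** Zs = mat 1"
    using arg_cong[OF YZ, of "star st"]
    by (simp add: star_expand star_defs matrix_mul_assoc)
  have XYs: "Ys ** Xs = mat 1" "Zs ** Xs = 0"
    using arg_cong[OF XY(1), of "star st"] arg_cong[OF XY(2), of "star st"]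
    by (simp_all add: star_expand star_defs)
  define S where "S = Y ** Bs ** Zs - \<epsilon> *\<^sub>R (Z ** B ** Ys)"
  define G where "G = \<epsilon> *\<^sub>R (Xs ** A1 ** X ** R) - Rs ** Xs ** A1s ** X"
  have XRY': "X ** (R ** Y) = 0" "X ** (R ** Z) = - mat 1" using XY by (simp_all add: matrix_mul_assoc)
  have GS: "G ** S = mat 1"
  proof -
    have "G ** S = Xs ** Ys - Rs ** Xs ** Zs"
      by (simp add: G_def S_def matrix_expand matrix_mult_assoc3[OF XY(1)] matrix_mult_assoc3[OF XY(2)]
          matrix_mult_assoc4[OF XRY'(1)] matrix_mult_assoc4[OF XRY'(2)]
          matrix_mult_assoc3[OF B(1)] matrix_mult_assoc3[OF Bs] e)
    then show ?thesis using YZs by simp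
  qed
  then have SG: "S ** G = mat 1" by (simp add: matrix_left_right_inverse)
  have Ss: "star st S = - (\<epsilon> *\<^sub>R S)"
    by (simp add: S_def star_expand star_defs matrix_expand scaleR_diff_right e)
  \<comment> \<open>Both terms of \<open>Ts ** G ** T\<close> contain one side of the solved equation or of its \<open>\<star>\<close>-image;
     after substitution the two terms with \<open>A0\<close> cancel because \<open>A0\<^sup>\<star> = \<epsilon> A0\<close>.\<close>
  have TGT: "Ts ** G ** T = G"
  proof -
    have 1: "A1s ** (X ** T) = - (A0 ** X) - \<epsilon> *\<^sub>R (A1 ** (X ** R))"
      using P0 by (simp add: matrix_mul_assoc algebra_simps eq_neg_iff_add_eq_0)
    have 2: "Ts ** (Xs ** A1) = - (\<epsilon> *\<^sub>R (Xs ** A0)) - \<epsilon> *\<^sub>R (Rs ** (Xs ** A1s))"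
      using arg_cong[OF 1, of "star st"]
      by (simp add: star_expand star_defs matrix_expand A0)
    have "Ts ** G ** T = \<epsilon> *\<^sub>R ((Ts ** (Xs ** A1)) ** X) - Xs ** (A1s ** (X ** T))"
      by (simp add: G_def matrix_expand TR matrix_mult_assoc3[OF TRs(1)])
    also have "\<dots> = G"
      unfolding 1 2 by (simp add: G_def matrix_expand scaleR_diff_right e)
    finally show ?thesis .
  qed
  have "S = T ** S ** Ts"
  proof -
    have "(T ** S ** Ts) ** G = T ** S ** (Ts ** G ** T) ** R"
      by (simp add: matrix_mul_assoc[symmetric] TR)
    also have "\<dots> = mat 1"
      unfolding TGT by (simp add: matrix_mul_assoc[symmetric] matrix_mult_assoc3[OF SG] TR)
    finally have "(T ** S ** Ts) ** (G ** S) = S" by (simp add: matrix_mul_assoc)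
    then show ?thesis by (simp add: GS)
  qed
  moreover have XSX: "X ** S ** Xs = 0"
    by (simp add: S_def matrix_expand matrix_mult_assoc3[OF XY(2)] XYs)
  ultimately have S: "S \<in> S_XT st \<epsilon> X T"
    by (simp add: S_XT_def S_T_def Ss star_defs)
  have M: "X ** R ** S ** Xs = \<epsilon> *\<^sub>R B"
    by (simp add: S_def matrix_expand matrix_mult_assoc4[OF XRY'(2)] XYs)
  have "matrix_inv (X ** R ** S ** Xs) = \<epsilon> *\<^sub>R A1"
    unfolding M by (rule matrix_inv_eqI) (simp_all add: matrix_expand B e)
  then have A1: "A1 = \<epsilon> *\<^sub>R matrix_inv (X ** R ** S ** Xs)" by (simp add: e)
  \<comment> \<open>Multiplying the equation by \<open>R ** S ** Xs\<close> removes its first term and isolates \<open>A0\<close>.\<close>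
  let ?N = "X ** R ** R ** S ** Xs"
  have "(A1s ** X ** T + A0 ** X + \<epsilon> *\<^sub>R (A1 ** X ** R)) ** R ** S ** Xs
      = A1s ** (X ** S ** Xs) + A0 ** (X ** R ** S ** Xs) + \<epsilon> *\<^sub>R (A1 ** ?N)"
    by (simp add: matrix_expand matrix_mult_assoc3[OF TR(1)])
  then have "\<epsilon> *\<^sub>R (A0 ** B + A1 ** ?N) = 0"
    unfolding P0 XSX M by (simp add: matrix_expand scaleR_add_right)
  then have "A0 ** B = - (A1 ** ?N)" using e by (auto simp: eq_neg_iff_add_eq_0)
  then have "A0 ** B ** A1 = - (A1 ** ?N ** A1)" by (simp add: matrix_mult_minus_left)
  then have "A0 = - (A1 ** ?N ** A1)" by (simp add: matrix_mul_assoc[symmetric] B)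
  then have "A0 = - (A1 ** X ** (R ** R) ** S ** Xs ** A1)" by (simp add: matrix_mul_assoc)
  moreover have "invertible S" using GS unfolding invertible_left_inverse by blast
  ultimately show ?thesis using that S A1 by (simp add: star_defs)
qed

section \<open>The equivalence\<close>

theorem theorem3p1:
  fixes st :: star_op and \<epsilon> :: real
    and X :: "complex^('n::finite + 'n)^'n"
    and T :: "complex^('n + 'n)^('n + 'n)"
  assumes "\<epsilon> \<in> {1, -1}"
    and "invertible T"
    and "invertible (stack X (- (X ** matrix_inv T)))"
  shows "((\<exists>A1 A0. regular_IEP_QP_solution st \<epsilon> X T A1 A0)
            \<longleftrightarrow> (\<exists>S \<in> S_XT st \<epsilon> X T. invertible S))
       \<and> (\<forall>S \<in> S_XT st \<epsilon> X T. invertible S \<longrightarrow>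
            invertible (X ** matrix_inv T ** S ** star st X) \<and>
            (\<forall>A1 A0.
               A1 = \<epsilon> *\<^sub>R matrix_inv (X ** matrix_inv T ** S ** star st X) \<and>
               A0 = - (A1 ** X ** (matrix_inv T ** matrix_inv T) ** S ** star st X ** A1)
               \<longrightarrow> regular_IEP_QP_solution st \<epsilon> X T A1 A0))
       \<and> (\<forall>A1 A0. regular_IEP_QP_solution st \<epsilon> X T A1 A0 \<longrightarrow>
            (\<exists>S \<in> S_XT st \<epsilon> X T. invertible S \<and>
               A1 = \<epsilon> *\<^sub>R matrix_inv (X ** matrix_inv T ** S ** star st X) \<and>
               A0 = - (A1 ** X ** (matrix_inv T ** matrix_inv T) ** S ** star st X ** A1)))"
proof -
  let ?R = "matrix_inv T"
  have e: "\<epsilon> * \<epsilon> = 1" using assms(1) by auto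
  have TR: "T ** ?R = mat 1" "?R ** T = mat 1"
    using assms(2) by (simp_all add: matrix_inv_mult)
  obtain Y Z where YZ: "X ** Y = mat 1" "X ** Z = 0" "- (X ** ?R) ** Y = 0"
      "- (X ** ?R) ** Z = mat 1" "Y ** X + Z ** (- (X ** ?R)) = mat 1"
    using invertible_stack_blocks[OF assms(3)] by blast
  have XRY: "X ** ?R ** Y = 0" using YZ(3) by (simp add: matrix_mult_minus_left)
  have XRZ: "X ** ?R ** Z = - mat 1"
    using YZ(4) by (metis matrix_mult_minus_left minus_minus)
  have YXZ: "Y ** X - Z ** X ** ?R = mat 1"
    using YZ(5) by (simp add: matrix_mult_minus_right matrix_mul_assoc)
  note fwd = solution_from_S[OF e TR _ _ XRZ YXZ]
  have bwd: "\<exists>S \<in> S_XT st \<epsilon> X T. invertible S \<and>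
               A1 = \<epsilon> *\<^sub>R matrix_inv (X ** ?R ** S ** star st X) \<and>
               A0 = - (A1 ** X ** (?R ** ?R) ** S ** star st X ** A1)"
    if "regular_IEP_QP_solution st \<epsilon> X T A1 A0" for A1 A0
    using S_from_solution[OF e TR YZ(1,2) XRY XRZ YXZ that] by metis
  show ?thesis
    using fwd bwd by blast
qed

end
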